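(* Let $S=\operatorname{diag}(s_1,\dots,s_\nu)$, $L=[1\ \cdots\ 1]\in\mathbb{R}^{1\times\nu}$, and write $C\Pi=[\eta_1\ \cdots\ \eta_\nu]$. Let $z_1,\dots,z_k\in\mathbb{R}$, $k\le\nu$, with $z_j\neq s_i$ for all $i,j$. Then the model $\Sigma_G:\ \dot\xi=(S-GL)\xi+Gu,\ \psi=C\Pi\xi$ has $z_1,\dots,z_k$ among the zeros of its transfer function $K_G(s)=C\Pi(sI-S+GL)^{-1}G$ if and only if the elements of $G=[g_1\ g_2\ \cdots\ g_\nu]^T$ satisfy the linear equations $$\sum_{i=1}^{\nu}\frac{\eta_i}{\gamma_{ji}}\,g_i=0,\qquad j=1,\dots,k,$$ where $\gamma_{ji}=z_j-s_i$ for $i=1,\dots,\nu$, $j=1,\dots,k$.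
   Context: $\sigma(M)$ denotes the spectrum of a matrix $M$. The single-input single-output system $\dot x=Ax+Bu,\ y=Cx$ has $A\in\mathbb{R}^{n\times n}$, $B\in\mathbb{R}^{n\times 1}$, $C\in\mathbb{R}^{1\times n}$, is controllable and observable, and is stable (all eigenvalues of $A$ have negative real part). $S\in\mathbb{C}^{\nu\times\nu}$ has spectrum closed under complex conjugation with $\sigma(S)\cap\sigma(A)=\emptyset$, and $(L,S)$ is observable (so for diagonal $S$ the $s_i$ are pairwise distinct). $\Pi\in\mathbb{C}^{n\times\nu}$ is the unique solution of $A\Pi+BL=\Pi S$. The parameter $G\in\mathbb{C}^\nu$ is such that $\sigma(S-GL)\cap\sigma(S)=\emptyset$. Convention: $z$ is called a zero of $\Sigma_G$ (or of $K_G$) if $$\det\begin{bmatrix} zI-S & G\\ C\Pi & 0\end{bmatrix}=0.$$ *)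

theory Defs
  imports
    Complex_Main
    "Jordan_Normal_Form.DL_Rank"
    "Jordan_Normal_Form.Spectral_Radius"
begin

definition complex_mat :: "real mat \<Rightarrow> complex mat" where
  "complex_mat = map_mat complex_of_real"

text \<open>Kalman's rank conditions for a single input (\<open>B\<close> is a column) and a single output
  (\<open>C\<close> is a row): the matrices \<open>[B, A B, \<dots>, A\<^sup>n\<^sup>-\<^sup>1 B]\<close> and
  \<open>[C; C A; \<dots>; C A\<^sup>n\<^sup>-\<^sup>1]\<close>, where \<open>n\<close> is the order of \<open>A\<close>, have rank \<open>n\<close>.\<close>

definition controllability_matrix :: "'a::field mat \<Rightarrow> 'a mat \<Rightarrow> 'a mat" where
  "controllability_matrix A B =
     mat (dim_row A) (dim_row A) (\<lambda>(i, j). (A ^\<^sub>m j * B) $$ (i, 0))"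

definition controllable :: "'a::field mat \<Rightarrow> 'a mat \<Rightarrow> bool" where
  "controllable A B \<longleftrightarrow>
     vec_space.rank (dim_row A) (controllability_matrix A B) = dim_row A"

definition observability_matrix :: "'a::field mat \<Rightarrow> 'a mat \<Rightarrow> 'a mat" where
  "observability_matrix C A =
     mat (dim_row A) (dim_row A) (\<lambda>(i, j). (C * A ^\<^sub>m i) $$ (0, j))"

definition observable :: "'a::field mat \<Rightarrow> 'a mat \<Rightarrow> bool" where
  "observable C A \<longleftrightarrow>
     vec_space.rank (dim_row A) (observability_matrix C A) = dim_row A"

definition stable_matrix :: "real mat \<Rightarrow> bool" where
  "stable_matrix A \<longleftrightarrow> (\<forall>l \<in> spectrum (complex_mat A). Re l < 0)"

text \<open>Zeros of the single-input single-output model \<open>\<xi>' = (S - G L) \<xi> + G u\<close>, \<open>\<psi> = H \<xi>\<close>,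
  equivalently of its transfer function \<open>K(s) = H (s I - S + G L)\<^sup>-\<^sup>1 G\<close>.  The row \<open>L\<close> does not
  occur: subtracting the last column times \<open>L\<close> from the first columns of the
  system matrix \<open>[z I - S + G L, G; H, 0]\<close> leaves its determinant unchanged.\<close>

definition is_zero_of_model ::
  "complex mat \<Rightarrow> complex mat \<Rightarrow> complex mat \<Rightarrow> complex \<Rightarrow> bool" where
  "is_zero_of_model S G H z \<longleftrightarrow>
     det (four_block_mat (z \<cdot>\<^sub>m 1\<^sub>m (dim_row S) - S) G H (0\<^sub>m 1 1)) = 0"

end

theory Submission
  imports Defs
begin

text \<open>Since \<open>z\<close> is not an eigenvalue of \<open>S\<close>, the block \<open>z I - S\<close> is an invertible diagonal matrix, and the
  Schur complement formula turns the determinant defining a zero into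
  \<open>\<Prod>\<^sub>i (z - s\<^sub>i)\<close> times \<open>- C \<Pi> (z I - S)\<^sup>-\<^sup>1 G = - \<Sum>\<^sub>i \<eta>\<^sub>i g\<^sub>i / (z - s\<^sub>i)\<close>.\<close>

text \<open>Block LU factorization: eliminating \<open>B\<close> with the invertible block
  \<open>A\<close> leaves a lower block triangular factor with diagonal blocks \<open>A\<close> and
  the Schur complement, times a unit upper block triangular factor of determinant 1.\<close>

lemma det_four_block_mat_Schur:
  fixes A A' B C D :: "'a::idom mat"
  assumes A: "A \<in> carrier_mat n n" and A': "A' \<in> carrier_mat n n" and inv: "A * A' = 1\<^sub>m n"
    and B: "B \<in> carrier_mat n m" and C: "C \<in> carrier_mat m n" and D: "D \<in> carrier_mat m m"
  shows "det (four_block_mat A B C D) = det A * det (D - C * A' * B)"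
proof -
  let ?L = "four_block_mat A (0\<^sub>m n m) C (D - C * A' * B)"
  let ?U = "four_block_mat (1\<^sub>m n) (A' * B) (0\<^sub>m m n) (1\<^sub>m m)"
  have A'B: "A' * B \<in> carrier_mat n m" and CA'B: "C * A' * B \<in> carrier_mat m m"
    using A' B C by auto
  \<comment> \<open>The inverse enters here: this product is the upper right block of
    \<open>?L * ?U\<close>.\<close>
  have AA'B: "A * (A' * B) = B"
    using assoc_mult_mat[OF A A' B] inv B by simp
  have CA'B': "C * (A' * B) = C * A' * B"
    using assoc_mult_mat[OF C A' B] by simp
  have E: "D - C * A' * B \<in> carrier_mat m m"
    by (rule minus_carrier_mat[OF CA'B])
  have "?L * ?U = four_block_mat (A * 1\<^sub>m n + 0\<^sub>m n m * 0\<^sub>m m n) (A * (A' * B) + 0\<^sub>m n m * 1\<^sub>m m)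
      (C * 1\<^sub>m n + (D - C * A' * B) * 0\<^sub>m m n) (C * (A' * B) + (D - C * A' * B) * 1\<^sub>m m)"
    by (rule mult_four_block_mat[OF A zero_carrier_mat C E one_carrier_mat A'B zero_carrier_mat one_carrier_mat])
  also have "\<dots> = four_block_mat A B C D"
  proof -
    \<comment> \<open>With \<open>X = C * A' * B\<close> this is the lower right block, where the
      Schur complement restores \<open>D\<close>.\<close>
    have "X + (D - X) = D" if "X \<in> carrier_mat m m" for X
      using that D by (intro eq_matI) auto
    from this[OF CA'B] show ?thesis
      unfolding AA'B CA'B' right_mult_one_mat[OF A] right_mult_one_mat[OF C]
        right_mult_one_mat[OF E] right_mult_zero_mat[OF E]
      using A B C by simp
  qed
  finally have "det (four_block_mat A B C D) = det (?L * ?U)"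
    by simp
  also have "\<dots> = det ?L * det ?U"
    by (rule det_mult[of _ "n + m"]; intro four_block_carrier_mat A E one_carrier_mat)
  also have "det ?L = det A * det (D - C * A' * B)"
    by (rule det_four_block_mat_upper_right_zero[OF A refl C E])
  also have "det ?U = 1"
    by (simp add: det_four_block_mat_lower_left_zero[OF one_carrier_mat A'B refl one_carrier_mat])
  finally show ?thesis by simp
qed

lemma det_mat_diag: "det (mat_diag n f) = (\<Prod>i<n. f i)"
proof -
  have "upper_triangular (mat_diag n f)"
    by (auto simp: mat_diag_def)
  then have "det (mat_diag n f) = prod_list (diag_mat (mat_diag n f))"
    by (rule det_upper_triangular) (rule mat_diag_dim)
  also have "\<dots> = (\<Prod>i<n. f i)"
    by (simp add: diag_mat_def mat_diag_def prod.list_conv_set_nth atLeast0LessThan)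
  finally show ?thesis .
qed

text \<open>The single-point form of the result, for an arbitrary output row \<open>H\<close> and
  complex \<open>z\<close>; it is later applied with \<open>H\<close> equal to C times \<Pi> and
  each real \<open>z j\<close>.\<close>

lemma is_zero_of_model_mat_diag_iff:
  assumes H: "H \<in> carrier_mat 1 \<nu>" and G: "G \<in> carrier_mat \<nu> 1"
    and ne: "\<And>i. i < \<nu> \<Longrightarrow> z \<noteq> s i"
  shows "is_zero_of_model (mat_diag \<nu> s) G H z \<longleftrightarrow>
    (\<Sum>i<\<nu>. H $$ (0, i) / (z - s i) * G $$ (i, 0)) = 0"
proof -
  let ?D = "mat_diag \<nu> (\<lambda>i. z - s i)" and ?D' = "mat_diag \<nu> (\<lambda>i. inverse (z - s i))"
  let ?E = "0\<^sub>m 1 1 - H * ?D' * G"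
  have D: "z \<cdot>\<^sub>m 1\<^sub>m (dim_row (mat_diag \<nu> s)) - mat_diag \<nu> s = ?D"
    by (rule eq_matI) (auto simp: mat_diag_def)
  \<comment> \<open>Since \<open>inverse 0 = 0\<close>, the diagonal entries of the product are 1
    only because \<open>z\<close> avoids every \<open>s i\<close>.\<close>
  have inv: "?D * ?D' = 1\<^sub>m \<nu>"
    by (simp only: mat_diag_diag) (rule eq_matI, auto simp: mat_diag_def ne)
  have E: "?E \<in> carrier_mat 1 1"
    using H G by (intro minus_carrier_mat mult_carrier_mat[of _ _ \<nu>]) auto
  have "det ?E = ?E $$ (0, 0)"
    using E by (simp add: det_single)
  \<comment> \<open>Right multiplication by \<open>?D'\<close> scales column \<open>i\<close> of
    \<open>H\<close> by \<open>inverse (z - s i)\<close>.\<close>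
  also have "\<dots> = - (\<Sum>i<\<nu>. H $$ (0, i) / (z - s i) * G $$ (i, 0))"
    using H G by (simp add: mat_diag_mult_right[OF H] scalar_prod_def divide_inverse atLeast0LessThan)
  finally have "det ?E = - (\<Sum>i<\<nu>. H $$ (0, i) / (z - s i) * G $$ (i, 0))" .
  moreover have "det (four_block_mat ?D G H (0\<^sub>m 1 1)) = det ?D * det ?E"
    by (rule det_four_block_mat_Schur[OF mat_diag_dim mat_diag_dim inv G H]) simp
  \<comment> \<open>Hence the full determinant vanishes exactly when the scalar
    \<open>det ?E\<close> does.\<close>
  moreover have "det ?D \<noteq> 0"
    using ne by (simp add: det_mat_diag)
  ultimately show ?thesis
    unfolding is_zero_of_model_def D by simp
qed

theorem proposition9:
  fixes n \<nu> k :: nat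
    and A B C :: "real mat"
    and S L P G :: "complex mat"
    and s \<eta> g :: "nat \<Rightarrow> complex"
    and z :: "nat \<Rightarrow> real"
    and \<gamma> :: "nat \<Rightarrow> nat \<Rightarrow> complex"
  assumes "A \<in> carrier_mat n n" and "B \<in> carrier_mat n 1" and "C \<in> carrier_mat 1 n"
    and "controllable A B" and "observable C A" and "stable_matrix A"
    and "S = mat_diag \<nu> s" and "L = mat 1 \<nu> (\<lambda>_. 1)"
    and "\<And>l. l \<in> spectrum S \<Longrightarrow> cnj l \<in> spectrum S"
    and "spectrum S \<inter> spectrum (complex_mat A) = {}"
    and "observable L S"
    and "P \<in> carrier_mat n \<nu>" and "complex_mat A * P + complex_mat B * L = P * S"
    and "\<And>i. i < \<nu> \<Longrightarrow> \<eta> i = (complex_mat C * P) $$ (0, i)"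
    and "G = mat \<nu> 1 (\<lambda>(i, _). g i)"
    and "spectrum (S - G * L) \<inter> spectrum S = {}"
    and "k \<le> \<nu>"
    and "\<And>j i. j < k \<Longrightarrow> i < \<nu> \<Longrightarrow> complex_of_real (z j) \<noteq> s i"
    and "\<And>j i. j < k \<Longrightarrow> i < \<nu> \<Longrightarrow> \<gamma> j i = complex_of_real (z j) - s i"
  shows "(\<forall>j<k. is_zero_of_model S G (complex_mat C * P) (complex_of_real (z j)))
     \<longleftrightarrow> (\<forall>j<k. (\<Sum>i<\<nu>. \<eta> i / \<gamma> j i * g i) = 0)"
proof -
  have H: "complex_mat C * P \<in> carrier_mat 1 \<nu>"
    using assms(3,12) by (auto simp: complex_mat_def)
  have G: "G \<in> carrier_mat \<nu> 1"
    using assms(15) by simp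
  have "is_zero_of_model S G (complex_mat C * P) (complex_of_real (z j)) \<longleftrightarrow>
      (\<Sum>i<\<nu>. \<eta> i / \<gamma> j i * g i) = 0" if "j < k" for j
  proof -
    \<comment> \<open>The values of \<open>\<eta>\<close> and \<open>\<gamma>\<close> are prescribed
      only for indices in range, so the sums are compared term by term.\<close>
    have "(\<Sum>i<\<nu>. (complex_mat C * P) $$ (0, i) / (complex_of_real (z j) - s i) * G $$ (i, 0)) =
        (\<Sum>i<\<nu>. \<eta> i / \<gamma> j i * g i)"
      by (rule sum.cong) (use that assms(14,15,19) in auto)
    then show ?thesis
      using is_zero_of_model_mat_diag_iff[OF H G assms(18)[OF that]] assms(7) by simp
  qed
  then show ?thesis by blast
qed

end
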